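(* Let $\mathbf{K}\in\{\mathbb{R},\mathbb{C}\}$, let $\mathcal{A}$ be a Banach algebra with multiplicative unit $e$, let $P\subset\mathcal{A}$ be a normal solid cone with induced partial order $\preceq$, let $\mathcal{V}$ be a vector space over $\mathbf{K}$, and let $\rho:\mathcal{V}\to\mathcal{A}$ be a cone modular functional with associated cone modular space $\mathcal{V}_\rho$. Suppose that $\mathcal{V}_\rho$ is $\rho$-complete and that $\rho$ satisfies the $\Delta_2$-condition. Let $T:\mathcal{V}_\rho\to\mathcal{V}_\rho$ be a cone contractive mapping, i.e. there exist $k\in P$ with spectral radius $r(k)<1$ and real numbers $\alpha>\beta>0$ such that $$\rho\left(\alpha(Tx-Ty)\right)\preceq k\,\rho\left(\beta(x-y)\right)\qquad\text{for all } x,y\in\mathcal{V}_\rho.$$ Then $T$ has a unique fixed point in $\mathcal{V}_\rho$.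
   Context: Banach algebra: a Banach space $\mathcal{A}$ over $\mathbf{K}\in\{\mathbb{R},\mathbb{C}\}$ with norm $\|\cdot\|_{\mathcal{A}}$ and an associative bilinear multiplication satisfying $\|uv\|_{\mathcal{A}}\le\|u\|_{\mathcal{A}}\|v\|_{\mathcal{A}}$. It is assumed to have a multiplicative unit $e$; its zero vector is $\theta_{\mathcal{A}}$. The zero vector of $\mathcal{V}$ is $\theta_{\mathcal{V}}$. The spectral radius of $a\in\mathcal{A}$ is $r(a)=\lim_{n\to\infty}\|a^n\|_{\mathcal{A}}^{1/n}=\inf_n\|a^n\|_{\mathcal{A}}^{1/n}$. Cone: a subset $P\subset\mathcal{A}$ such that (1) $\{e,\theta_{\mathcal{A}}\}\subset P$; (2) $\mu P+\beta P\subset P$ for all real $\mu,\beta\ge 0$; (3) $PP\subset P$; (4) $P\cap(-P)=\{\theta_{\mathcal{A}}\}$. The partial order is $u\preceq v$ iff $v-u\in P$ (and $u\succeq v$ means $v\preceq u$). $P$ is solid if its interior is nonempty. $P$ is normal if there is $L>0$ such that $\theta_{\mathcal{A}}\preceq x\preceq y$ implies $\|x\|_{\mathcal{A}}\le L\|y\|_{\mathcal{A}}$ for all $x,y\in\mathcal{A}$. Cone modular functional: a map $\rho:\mathcal{V}\to\mathcal{A}$ such that for all $u,v\in\mathcal{V}$: (1) $\rho(u)\succeq\theta_{\mathcal{A}}$, and $\rho(u)=\theta_{\mathcal{A}}$ iff $u=\theta_{\mathcal{V}}$; (2) $\rho(\alpha u)=\rho(u)$ for every $\alpha\in\mathbf{K}$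 with $|\alpha|=1$; (3) $\rho(\alpha u+\beta v)\preceq\rho(u)+\rho(v)$ whenever $\alpha,\beta\ge 0$ and $\alpha+\beta=1$. Cone modular space over $\mathcal{A}$: $\mathcal{V}_\rho=\{x\in\mathcal{V}:\lim_{\lambda\to 0}\rho(\lambda x)=\theta_{\mathcal{A}}\}$ (limit in the norm of $\mathcal{A}$), which is a vector subspace of $\mathcal{V}$. Let $\{x_n\}$ be a sequence in $\mathcal{V}_\rho$. - $\{x_n\}$ is $\rho$-convergent to $x\in\mathcal{V}_\rho$ if there is $\mu>0$ such that for each $\varepsilon>0$ there is $N\in\mathbb{N}$ with $\|\rho(\mu(x_n-x))\|_{\mathcal{A}}<\varepsilon$ for all $n\ge N$. - $\{x_n\}$ is $\rho$-Cauchy if there is $\mu>0$ such that for each $\varepsilon>0$ there is $N\in\mathbb{N}$ with $\|\rho(\mu(x_n-x_m))\|_{\mathcal{A}}<\varepsilon$ for all $n,m\ge N$. - $\mathcal{V}_\rho$ is $\rho$-complete if every $\rho$-Cauchy sequence in $\mathcal{V}_\rho$ is $\rho$-convergent to some element of $\mathcal{V}_\rho$. - $\rho$ satisfies the $\Delta_2$-condition if, for every sequence $\{x_n\}$ in $\mathcal{V}_\rho$, $\|\rho(x_n)\|_{\mathcal{A}}\to 0$ implies $\|\rho(2x_n)\|_{\mathcal{A}}\to 0$. *)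

theory Defs
  imports "HOL-Analysis.Analysis"
begin

text \<open>
  The scalar field is a type \<open>'k\<close> of class \<^class>\<open>real_normed_field\<close>. By the theorems of
  Ostrowski and Gelfand--Mazur such a field is \<open>\<real>\<close> or \<open>\<complex>\<close> with the usual absolute value,
  up to isometric isomorphism. A real scalar \<open>r\<close> acts on a \<open>'k\<close>-vector space as \<open>of_real r\<close>.

  A real Banach algebra with unit \<open>1\<close> is a type of sort
  \<open>{real_normed_algebra, monoid_mult, banach}\<close>. Unlike \<^class>\<open>real_normed_algebra_1\<close>, this sort
  requires neither \<open>norm 1 = 1\<close> nor \<open>0 \<noteq> 1\<close>.
  The following predicate says that \<open>smul\<close> extends the real scalar multiplication to one by
  \<open>'k\<close>, making the type a Banach algebra over \<open>'k\<close>.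
\<close>

definition banach_algebra_over ::
  "('k::real_normed_field \<Rightarrow> 'a::{real_normed_algebra, monoid_mult, banach} \<Rightarrow> 'a) \<Rightarrow> bool"
  where "banach_algebra_over smul \<longleftrightarrow>
    vector_space smul \<and>
    (\<forall>r a. smul (of_real r) a = r *\<^sub>R a) \<and>
    (\<forall>c a. norm (smul c a) = norm c * norm a) \<and>
    (\<forall>c a b. smul c a * b = smul c (a * b) \<and> a * smul c b = smul c (a * b))"

definition spectral_radius :: "'a::{real_normed_algebra, monoid_mult} \<Rightarrow> real"
  where "spectral_radius a = lim (\<lambda>n. root n (norm (a ^ n)))"

definition algebra_cone :: "'a::{real_normed_algebra, monoid_mult} set \<Rightarrow> bool"
  where "algebra_cone P \<longleftrightarrow>
    {1, 0} \<subseteq> P \<and>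
    (\<forall>\<mu>\<ge>0. \<forall>\<beta>\<ge>0. \<forall>u\<in>P. \<forall>v\<in>P. \<mu> *\<^sub>R u + \<beta> *\<^sub>R v \<in> P) \<and>
    (\<forall>u\<in>P. \<forall>v\<in>P. u * v \<in> P) \<and>
    P \<inter> uminus ` P = {0}"

definition cone_le :: "'a::group_add set \<Rightarrow> 'a \<Rightarrow> 'a \<Rightarrow> bool"
  where "cone_le P u v \<longleftrightarrow> v - u \<in> P"

definition solid_cone :: "'a::topological_space set \<Rightarrow> bool"
  where "solid_cone P \<longleftrightarrow> interior P \<noteq> {}"

definition normal_cone :: "'a::real_normed_vector set \<Rightarrow> bool"
  where "normal_cone P \<longleftrightarrow>
    (\<exists>L>0. \<forall>x y. cone_le P 0 x \<and> cone_le P x y \<longrightarrow> norm x \<le> L * norm y)"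

definition cone_modular ::
  "('k::real_normed_field \<Rightarrow> 'v::ab_group_add \<Rightarrow> 'v) \<Rightarrow> 'a::real_normed_vector set
    \<Rightarrow> ('v \<Rightarrow> 'a) \<Rightarrow> bool"
  where "cone_modular smul P \<rho> \<longleftrightarrow>
    (\<forall>u. cone_le P 0 (\<rho> u) \<and> (\<rho> u = 0 \<longleftrightarrow> u = 0)) \<and>
    (\<forall>c u. norm c = 1 \<longrightarrow> \<rho> (smul c u) = \<rho> u) \<and>
    (\<forall>\<alpha> \<beta> u v. \<alpha> \<ge> 0 \<and> \<beta> \<ge> 0 \<and> \<alpha> + \<beta> = 1 \<longrightarrow>
      cone_le P (\<rho> (smul (of_real \<alpha>) u + smul (of_real \<beta>) v)) (\<rho> u + \<rho> v))"

definition modular_space ::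
  "('k::real_normed_field \<Rightarrow> 'v::ab_group_add \<Rightarrow> 'v) \<Rightarrow> ('v \<Rightarrow> 'a::real_normed_vector) \<Rightarrow> 'v set"
  where "modular_space smul \<rho> = {x. ((\<lambda>c. \<rho> (smul c x)) \<longlongrightarrow> 0) (at 0)}"

definition modular_convergent ::
  "('k::real_normed_field \<Rightarrow> 'v::ab_group_add \<Rightarrow> 'v) \<Rightarrow> ('v \<Rightarrow> 'a::real_normed_vector)
    \<Rightarrow> (nat \<Rightarrow> 'v) \<Rightarrow> 'v \<Rightarrow> bool"
  where "modular_convergent smul \<rho> X x \<longleftrightarrow>
    (\<exists>\<mu>>0. \<forall>\<epsilon>>0. \<exists>N. \<forall>n\<ge>N. norm (\<rho> (smul (of_real \<mu>) (X n - x))) < \<epsilon>)"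

definition modular_Cauchy ::
  "('k::real_normed_field \<Rightarrow> 'v::ab_group_add \<Rightarrow> 'v) \<Rightarrow> ('v \<Rightarrow> 'a::real_normed_vector)
    \<Rightarrow> (nat \<Rightarrow> 'v) \<Rightarrow> bool"
  where "modular_Cauchy smul \<rho> X \<longleftrightarrow>
    (\<exists>\<mu>>0. \<forall>\<epsilon>>0. \<exists>N. \<forall>n\<ge>N. \<forall>m\<ge>N. norm (\<rho> (smul (of_real \<mu>) (X n - X m))) < \<epsilon>)"

definition modular_complete ::
  "('k::real_normed_field \<Rightarrow> 'v::ab_group_add \<Rightarrow> 'v) \<Rightarrow> ('v \<Rightarrow> 'a::real_normed_vector) \<Rightarrow> bool"
  where "modular_complete smul \<rho> \<longleftrightarrow>
    (\<forall>X. range X \<subseteq> modular_space smul \<rho> \<and> modular_Cauchy smul \<rho> X \<longrightarrow>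
      (\<exists>x\<in>modular_space smul \<rho>. modular_convergent smul \<rho> X x))"

definition Delta2_condition ::
  "('k::real_normed_field \<Rightarrow> 'v::ab_group_add \<Rightarrow> 'v) \<Rightarrow> ('v \<Rightarrow> 'a::real_normed_vector) \<Rightarrow> bool"
  where "Delta2_condition smul \<rho> \<longleftrightarrow>
    (\<forall>X. range X \<subseteq> modular_space smul \<rho> \<and> (\<lambda>n. norm (\<rho> (X n))) \<longlonglongrightarrow> 0 \<longrightarrow>
      (\<lambda>n. norm (\<rho> (smul 2 (X n)))) \<longlonglongrightarrow> 0)"

definition cone_contractive ::
  "('k::real_normed_field \<Rightarrow> 'v::ab_group_add \<Rightarrow> 'v)
    \<Rightarrow> 'a::{real_normed_algebra, monoid_mult} set \<Rightarrow> ('v \<Rightarrow> 'a) \<Rightarrow> ('v \<Rightarrow> 'v) \<Rightarrow> bool"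
  where "cone_contractive smul P \<rho> T \<longleftrightarrow>
    (\<exists>k\<in>P. spectral_radius k < 1 \<and>
      (\<exists>\<alpha> \<beta>. \<alpha> > \<beta> \<and> \<beta> > 0 \<and>
        (\<forall>x\<in>modular_space smul \<rho>. \<forall>y\<in>modular_space smul \<rho>.
          cone_le P (\<rho> (smul (of_real \<alpha>) (T x - T y))) (k * \<rho> (smul (of_real \<beta>) (x - y))))))"

text \<open>The limit defining the spectral radius exists, and it equals the infimum.\<close>

lemma norm_power_mult_add_le:
  fixes a :: "'a::{real_normed_algebra, monoid_mult}"
  assumes "norm (a ^ m) \<le> q"
  shows "norm (a ^ (m * d + r)) \<le> q ^ d * norm (a ^ r)"
proof (induction d)
  case (Suc d)
  have "0 \<le> q"
    using assms norm_ge_zero order_trans by blast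
  have "a ^ (m * Suc d + r) = a ^ m * a ^ (m * d + r)"
    by (simp add: power_add mult.assoc)
  then have "norm (a ^ (m * Suc d + r)) \<le> norm (a ^ m) * norm (a ^ (m * d + r))"
    by (simp add: norm_mult_ineq)
  also have "\<dots> \<le> q * (q ^ d * norm (a ^ r))"
    using Suc assms \<open>0 \<le> q\<close> by (intro mult_mono) auto
  finally show ?case by (simp add: mult.assoc)
qed simp

lemma spectral_radius_LIMSEQ:
  fixes a :: "'a::{real_normed_algebra, monoid_mult}"
  shows "(\<lambda>n. root n (norm (a ^ n))) \<longlonglongrightarrow> (INF n\<in>{1..}. root n (norm (a ^ n)))"
proof -
  define f where "f n = root n (norm (a ^ n))" for n
  define c where "c = (INF n\<in>{1..}. f n)"
  have f0: "0 \<le> f n" for n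
    unfolding f_def by (intro real_root_ge_zero norm_ge_zero)
  have bdd: "bdd_below (f ` {1..})"
    by (rule bdd_belowI[of _ 0]) (use f0 in auto)
  have lower: "c \<le> f n" if "n \<ge> 1" for n
    unfolding c_def using that by (intro cINF_lower bdd) auto
  have c0: "0 \<le> c"
    unfolding c_def by (rule cINF_greatest) (use f0 in auto)
  have upper: "\<forall>\<^sub>F n in sequentially. f n < s" if "c < s" for s
  proof -
    obtain q where q: "c < q" "q < s"
      using dense[OF \<open>c < s\<close>] by blast
    then have q0: "0 < q" using c0 by linarith
    have "\<exists>m\<in>{1..}. f m < q"
      using q(1) bdd unfolding c_def by (subst (asm) cINF_less_iff) auto
    then obtain m where m: "m \<ge> 1" "f m < q" by auto
    have am: "norm (a ^ m) \<le> q ^ m"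
    proof -
      have "norm (a ^ m) = f m ^ m"
        unfolding f_def using m(1) by simp
      also have "\<dots> \<le> q ^ m"
        using m(2) f0 by (intro power_mono) auto
      finally show ?thesis .
    qed
    define M where "M = 1 + (\<Sum>r<m. norm (a ^ r) / q ^ r)"
    have M0: "0 < M"
      unfolding M_def using q0 by (intro add_pos_nonneg sum_nonneg) auto
    have le: "norm (a ^ n) \<le> M * q ^ n" for n
    proof -
      define d r where "d = n div m" and "r = n mod m"
      have n: "n = m * d + r" and r: "r < m"
        unfolding d_def r_def using m(1) by auto
      have "norm (a ^ r) / q ^ r \<le> (\<Sum>r<m. norm (a ^ r) / q ^ r)"
        using r q0 by (intro member_le_sum) auto
      then have "norm (a ^ r) / q ^ r \<le> M" unfolding M_def by linarith
      then have "norm (a ^ r) \<le> M * q ^ r"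
        using q0 by (simp add: field_simps)
      then have "(q ^ m) ^ d * norm (a ^ r) \<le> (q ^ m) ^ d * (M * q ^ r)"
        using q0 by (intro mult_left_mono) auto
      moreover have "norm (a ^ n) \<le> (q ^ m) ^ d * norm (a ^ r)"
        unfolding n using am by (rule norm_power_mult_add_le)
      moreover have "(q ^ m) ^ d * (M * q ^ r) = M * q ^ n"
        unfolding n by (simp add: power_add flip: power_mult)
      ultimately show ?thesis by linarith
    qed
    have fM: "f n \<le> root n M * q" if "n \<ge> 1" for n
    proof -
      have "f n \<le> root n (M * q ^ n)"
        unfolding f_def using that le by (intro real_root_le_mono) auto
      also have "\<dots> = root n M * q"
        using that q0 by (simp add: real_root_mult real_root_power_cancel)
      finally show ?thesis .
    qed
    have "(\<lambda>n. root n M * q) \<longlonglongrightarrow> 1 * q"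
      by (intro tendsto_mult LIMSEQ_root_const M0 tendsto_const)
    then have "\<forall>\<^sub>F n in sequentially. root n M * q < s"
      using q(2) by (intro order_tendstoD(2)[where y = "1 * q"]) auto
    then show ?thesis
      using eventually_ge_at_top[of 1]
      by eventually_elim (use fM in \<open>meson le_less_trans\<close>)
  qed
  have "f \<longlonglongrightarrow> c"
  proof (rule order_tendstoI)
    fix s assume "s < c"
    then show "\<forall>\<^sub>F n in sequentially. s < f n"
      using lower by (intro eventually_at_top_linorderI[of 1]) (meson less_le_trans)
  qed (use upper in auto)
  then show ?thesis unfolding c_def f_def .
qed

lemma spectral_radius_eq_INF:
  "spectral_radius a = (INF n\<in>{1..}. root n (norm (a ^ n)))"
  unfolding spectral_radius_def by (rule limI) (rule spectral_radius_LIMSEQ)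

end

theory Submission imports Defs begin

text \<open>
  Let \<open>x\<^sub>n\<close> be the orbit of \<open>0\<close> under \<open>T\<close>. Choosing \<open>\<gamma>\<close> with \<open>\<beta> / \<alpha> + \<beta> / \<gamma> = 1\<close>, convexity and
  contractivity give \<open>\<rho> (\<beta> (x\<^sub>p\<^sub>+\<^sub>1 - x\<^sub>0)) \<preceq> k \<rho> (\<beta> (x\<^sub>p - x\<^sub>0)) + \<rho> (\<gamma> (x\<^sub>1 - x\<^sub>0))\<close>. As the powers of
  \<open>k\<close> are absolutely summable, the left-hand sides are bounded in norm uniformly in \<open>p\<close>, and
  \<open>\<rho> (\<beta> (x\<^sub>n\<^sub>+\<^sub>p - x\<^sub>n)) \<preceq> k\<^sup>n \<rho> (\<beta> (x\<^sub>p - x\<^sub>0))\<close> makes the orbit \<open>\<rho>\<close>-Cauchy. By the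
  \<open>\<Delta>\<^sub>2\<close>-condition it converges to its limit at every scale, so the limit is a fixed point.
\<close>

text \<open>The root test applies because the roots converge to the spectral radius. Summability
  gives both a uniform bound on partial sums and the decay of the powers.\<close>

lemma spectral_radius_less_1_imp_summable:
  fixes k :: "'a::{real_normed_algebra, monoid_mult}"
  assumes "spectral_radius k < 1"
  shows "summable (\<lambda>n. norm (k ^ n))"
proof (rule root_test_convergence)
  show "(\<lambda>n. root n (norm (norm (k ^ n)))) \<longlonglongrightarrow> spectral_radius k"
    using spectral_radius_LIMSEQ[of k] by (simp add: spectral_radius_eq_INF)
qed (use assms in auto)

section \<open>Order and norm estimates in a normal cone\<close>

locale normal_algebra_cone =
  fixes P :: "'a::{real_normed_algebra, monoid_mult} set" and L :: real
  assumes cone: "algebra_cone P"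
    and L_pos: "0 < L"
    and normal: "\<And>x y. cone_le P 0 x \<Longrightarrow> cone_le P x y \<Longrightarrow> norm x \<le> L * norm y"
begin

abbreviation le :: "'a \<Rightarrow> 'a \<Rightarrow> bool" (infix "\<preceq>" 50)
  where "x \<preceq> y \<equiv> cone_le P x y"

lemma zero_mem: "0 \<in> P" and one_mem: "1 \<in> P"
  using cone by (auto simp: algebra_cone_def)

lemma add_mem: "u \<in> P \<Longrightarrow> v \<in> P \<Longrightarrow> u + v \<in> P"
  using cone unfolding algebra_cone_def by (metis scaleR_one zero_le_one)

lemma mult_mem: "u \<in> P \<Longrightarrow> v \<in> P \<Longrightarrow> u * v \<in> P"
  using cone by (auto simp: algebra_cone_def)

lemma power_mem: "u \<in> P \<Longrightarrow> u ^ n \<in> P"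
  by (induction n) (auto simp: one_mem mult_mem)

lemma le_refl: "x \<preceq> x"
  by (simp add: cone_le_def zero_mem)

lemma le_trans [trans]: "x \<preceq> y \<Longrightarrow> y \<preceq> z \<Longrightarrow> x \<preceq> z"
  using add_mem[of "y - x" "z - y"] by (simp add: cone_le_def)

lemma le_add_mono: "x \<preceq> y \<Longrightarrow> z \<preceq> w \<Longrightarrow> x + z \<preceq> y + w"
  using add_mem[of "y - x" "w - z"] by (simp add: cone_le_def algebra_simps)

lemma le_mult_left_mono: "k \<in> P \<Longrightarrow> x \<preceq> y \<Longrightarrow> k * x \<preceq> k * y"
  using mult_mem[of k "y - x"] by (simp add: cone_le_def algebra_simps)

lemma le_power_mult:
  assumes "k \<in> P" and "\<And>n. a (Suc n) \<preceq> k * a n"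
  shows "a n \<preceq> k ^ n * a 0"
proof (induction n)
  case (Suc n)
  have "a (Suc n) \<preceq> k * a n" by (rule assms)
  also have "k * a n \<preceq> k * (k ^ n * a 0)"
    by (rule le_mult_left_mono[OF assms(1) Suc])
  finally show ?case by (simp add: mult.assoc)
qed (simp add: le_refl)

text \<open>Unrolling the recursion from the value 0 collects one factor \<open>k\<close> per step,
  since left multiplication by \<open>k\<close> is monotone.\<close>

lemma le_geometric_sum:
  assumes "k \<in> P" and "a 0 = 0" and "\<And>n. a (Suc n) \<preceq> k * a n + c"
  shows "a n \<preceq> (\<Sum>i<n. k ^ i) * c"
proof (induction n)
  case (Suc n)
  have "a (Suc n) \<preceq> k * a n + c" by (rule assms)
  also have "k * a n + c \<preceq> k * ((\<Sum>i<n. k ^ i) * c) + c"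
    by (intro le_add_mono le_mult_left_mono assms(1) Suc le_refl)
  \<comment> \<open>The added \<open>c\<close> becomes the new bottom term \<open>k ^ 0 * c\<close>;
    multiplication by \<open>k\<close> shifts the other exponents up by one.\<close>
  also have "k * ((\<Sum>i<n. k ^ i) * c) + c = (\<Sum>i<Suc n. k ^ i) * c"
    by (subst sum.lessThan_Suc_shift)
      (simp add: algebra_simps sum_distrib_left flip: mult.assoc)
  finally show ?case .
qed (simp add: assms(2) le_refl)

text \<open>Normality turns the bound by partial geometric sums into a norm bound, and the series of
  norms makes it independent of \<open>n\<close>.\<close>

lemma norm_le_suminf:
  assumes "k \<in> P" and "summable (\<lambda>n. norm (k ^ n))" and "a 0 = 0"
    and "\<And>n. 0 \<preceq> a n" and "\<And>n. a (Suc n) \<preceq> k * a n + c"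
  shows "norm (a n) \<le> L * ((\<Sum>i. norm (k ^ i)) * norm c)"
proof -
  have "norm (a n) \<le> L * norm ((\<Sum>i<n. k ^ i) * c)"
    by (intro normal assms(4) le_geometric_sum assms)
  also have "norm ((\<Sum>i<n. k ^ i) * c) \<le> norm (\<Sum>i<n. k ^ i) * norm c"
    by (rule norm_mult_ineq)
  also have "norm (\<Sum>i<n. k ^ i) \<le> (\<Sum>i. norm (k ^ i))"
    by (rule order_trans[OF norm_sum sum_le_suminf[OF assms(2)]]) auto
  finally show ?thesis using L_pos by (simp add: mult_left_mono mult_right_mono)
qed

text \<open>The squeeze principle for the cone order: by normality, \<open>norm (f x)\<close> is at
  most \<open>L * norm (g x)\<close>.\<close>

lemma tendsto_zero_mono:
  assumes "\<forall>\<^sub>F x in F. 0 \<preceq> f x \<and> f x \<preceq> g x" and "(g \<longlongrightarrow> 0) F"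
  shows "(f \<longlongrightarrow> 0) F"
proof (rule Lim_null_comparison)
  show "\<forall>\<^sub>F x in F. norm (f x) \<le> L * norm (g x)"
    using assms(1) by eventually_elim (auto intro: normal)
  show "((\<lambda>x. L * norm (g x)) \<longlongrightarrow> 0) F"
    by (intro tendsto_mult_right_zero tendsto_norm_zero assms)
qed

end

section \<open>Cone modular functionals and the modular space\<close>

locale cone_modular_functional = normal_algebra_cone P L + vector_space smul
  for P :: "'a::{real_normed_algebra, monoid_mult} set" and L
    and smul :: "'k::real_normed_field \<Rightarrow> 'v::ab_group_add \<Rightarrow> 'v" +
  fixes \<rho> :: "'v \<Rightarrow> 'a"
  assumes modular: "cone_modular smul P \<rho>"
begin

abbreviation rmul :: "real \<Rightarrow> 'v \<Rightarrow> 'v" (infixr "\<cdot>" 75)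
  where "r \<cdot> u \<equiv> smul (of_real r) u"

lemma rho_nonneg: "0 \<preceq> \<rho> u" and rho_eq_0_iff: "\<rho> u = 0 \<longleftrightarrow> u = 0"
  using modular by (auto simp: cone_modular_def)

lemma rho_convex: "\<alpha> \<ge> 0 \<Longrightarrow> \<beta> \<ge> 0 \<Longrightarrow> \<alpha> + \<beta> = 1 \<Longrightarrow> \<rho> (\<alpha> \<cdot> u + \<beta> \<cdot> v) \<preceq> \<rho> u + \<rho> v"
  using modular by (auto simp: cone_modular_def)

lemma rho_minus: "\<rho> (- u) = \<rho> u"
proof -
  have "\<rho> (smul (- 1) u) = \<rho> u"
    using modular unfolding cone_modular_def by (metis norm_minus_cancel norm_one)
  then show ?thesis by simp
qed

lemma rho_scale_minus_commute: "\<rho> (smul c (x - y)) = \<rho> (smul c (y - x))"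
  using rho_minus[of "smul c (x - y)"] by (simp add: scale_right_diff_distrib)

text \<open>For \<open>t\<close> nonzero, the vector scaled by \<open>s\<close> is the convex
  combination of the vector scaled by \<open>t\<close> and 0, with weight \<open>s / t\<close> on
  the former, and \<rho> vanishes at 0.\<close>

lemma rho_mono:
  assumes "0 \<le> s" "s \<le> t"
  shows "\<rho> (s \<cdot> u) \<preceq> \<rho> (t \<cdot> u)"
proof (cases "t = 0")
  case True
  then show ?thesis using assms by (simp add: le_refl)
next
  case False
  then have "\<rho> ((s / t) \<cdot> t \<cdot> u + (1 - s / t) \<cdot> 0) \<preceq> \<rho> (t \<cdot> u) + \<rho> 0"
    using assms by (intro rho_convex) (auto simp: field_simps)
  then show ?thesis
    using False rho_eq_0_iff[of 0] by (simp del: of_real_divide flip: of_real_mult)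
qed

text \<open>A triangle inequality whose first summand carries the larger scale \<alpha>, so that
  contractivity can return it to \<beta>. With weights \<open>\<beta> / \<alpha>\<close> and
  \<open>1 - \<beta> / \<alpha>\<close>, the second scale is forced by
  \<open>(1 - \<beta> / \<alpha>) * \<gamma> = \<beta>\<close>.\<close>

lemma rho_add:
  assumes "0 < \<beta>" "\<beta> < \<alpha>"
  shows "\<rho> (\<beta> \<cdot> (u + v)) \<preceq> \<rho> (\<alpha> \<cdot> u) + \<rho> ((\<alpha> * \<beta> / (\<alpha> - \<beta>)) \<cdot> v)"
proof -
  define \<gamma> where "\<gamma> = \<alpha> * \<beta> / (\<alpha> - \<beta>)"
  have eq: "\<beta> / \<alpha> * \<alpha> = \<beta>" "(1 - \<beta> / \<alpha>) * \<gamma> = \<beta>"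
    using assms unfolding \<gamma>_def by (auto simp: divide_simps)
  have "\<rho> ((\<beta> / \<alpha>) \<cdot> \<alpha> \<cdot> u + (1 - \<beta> / \<alpha>) \<cdot> \<gamma> \<cdot> v) \<preceq> \<rho> (\<alpha> \<cdot> u) + \<rho> (\<gamma> \<cdot> v)"
    using assms by (intro rho_convex) (auto simp: field_simps)
  then show ?thesis
    unfolding \<gamma>_def[symmetric] scale_scale of_real_mult[symmetric] eq
    by (simp add: scale_right_distrib)
qed

lemma zero_mem_modular_space: "0 \<in> modular_space smul \<rho>"
  using rho_eq_0_iff[of 0] by (simp add: modular_space_def)

lemma add_mem_modular_space:
  assumes "x \<in> modular_space smul \<rho>" "y \<in> modular_space smul \<rho>"
  shows "x + y \<in> modular_space smul \<rho>"
proof -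
  \<comment> \<open>The filter is punctured at 0, so the substitution must also preserve nonzero
    scalars. The factor 2 undoes the weights 1/2 in the convexity estimate.\<close>
  have at0: "filterlim (\<lambda>c::'k. 2 * c) (at 0) (at 0)"
    by (rule filterlim_atI)
      (auto intro!: tendsto_eq_intros simp: eventually_at_filter)
  have "((\<lambda>c. \<rho> (smul (2 * c) x) + \<rho> (smul (2 * c) y)) \<longlongrightarrow> 0 + 0) (at 0)"
    using assms unfolding modular_space_def
    by (intro tendsto_add filterlim_compose[OF _ at0]) auto
  moreover have "\<rho> (smul c (x + y)) \<preceq> \<rho> (smul (2 * c) x) + \<rho> (smul (2 * c) y)" for c
    using rho_convex[of "1/2" "1/2" "smul (2 * c) x" "smul (2 * c) y"]
    by (simp add: scale_right_distrib)
  ultimately show ?thesis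
    unfolding modular_space_def mem_Collect_eq
    by (intro tendsto_zero_mono[where f = "\<lambda>c. \<rho> (smul c (x + y))"] always_eventually allI conjI
        rho_nonneg) simp_all
qed

lemma scale_mem_modular_space:
  assumes "x \<in> modular_space smul \<rho>"
  shows "smul a x \<in> modular_space smul \<rho>"
proof (cases "a = 0")
  case True
  then show ?thesis by (simp add: zero_mem_modular_space)
next
  case False
  then have "filterlim (\<lambda>c::'k. c * a) (at 0) (at 0)"
    by (intro filterlim_atI) (auto intro!: tendsto_eq_intros simp: eventually_at_filter)
  from filterlim_compose[OF _ this] show ?thesis
    using assms by (fastforce simp: modular_space_def)
qed

lemma diff_mem_modular_space:
  assumes "x \<in> modular_space smul \<rho>" "y \<in> modular_space smul \<rho>"
  shows "x - y \<in> modular_space smul \<rho>"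
  using add_mem_modular_space[OF assms(1) scale_mem_modular_space[OF assms(2), of "-1"]]
  by simp

text \<open>Iterating the condition doubles the scale \<mu> until it exceeds \<open>s\<close>;
  monotonicity in the scale then brings the limit down to \<open>s\<close>.\<close>

lemma Delta2_tendsto_all_scales:
  assumes "Delta2_condition smul \<rho>" and "\<And>n. Y n \<in> modular_space smul \<rho>"
    and "0 < \<mu>" and "(\<lambda>n. \<rho> (\<mu> \<cdot> Y n)) \<longlonglongrightarrow> 0" and "0 \<le> s"
  shows "(\<lambda>n. \<rho> (s \<cdot> Y n)) \<longlonglongrightarrow> 0"
proof -
  have double: "(\<lambda>n. \<rho> ((2 ^ j * \<mu>) \<cdot> Y n)) \<longlonglongrightarrow> 0" for j
  proof (induction j)
    case (Suc j)
    let ?Z = "\<lambda>n. (2 ^ j * \<mu>) \<cdot> Y n"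
    have "range ?Z \<subseteq> modular_space smul \<rho>"
      using assms(2) scale_mem_modular_space by blast
    then have "(\<lambda>n. norm (\<rho> (smul 2 (?Z n)))) \<longlonglongrightarrow> 0"
      using assms(1) tendsto_norm_zero[OF Suc] unfolding Delta2_condition_def
      by (elim allE[of _ ?Z] impE) (rule conjI)
    then show ?case by (simp add: tendsto_norm_zero_iff mult.assoc)
  qed (use assms(4) in simp)
  obtain j where "s / \<mu> < 2 ^ j"
    using real_arch_pow[of 2 "s / \<mu>"] by auto
  then have "s \<le> 2 ^ j * \<mu>"
    using assms(3) by (simp add: field_simps)
  then show ?thesis
    using assms(5)
    by (intro tendsto_zero_mono[OF _ double[of j]] always_eventually allI conjI rho_nonneg rho_mono)
qed

end

section \<open>Contractions: uniqueness and existence of the fixed point\<close>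

locale cone_contraction = cone_modular_functional P L smul \<rho>
  for P :: "'a::{real_normed_algebra, monoid_mult} set" and L
    and smul :: "'k::real_normed_field \<Rightarrow> 'v::ab_group_add \<Rightarrow> 'v" and \<rho> +
  fixes T :: "'v \<Rightarrow> 'v" and k :: 'a and \<alpha> \<beta> :: real
  assumes self_map: "T \<in> modular_space smul \<rho> \<rightarrow> modular_space smul \<rho>"
    and k_mem: "k \<in> P" and spectral: "spectral_radius k < 1"
    and scales: "0 < \<beta>" "\<beta> < \<alpha>"
    and contr: "\<And>x y. x \<in> modular_space smul \<rho> \<Longrightarrow> y \<in> modular_space smul \<rho> \<Longrightarrow>
      \<rho> (\<alpha> \<cdot> (T x - T y)) \<preceq> k * \<rho> (\<beta> \<cdot> (x - y))"
begin

abbreviation V :: "'v set" where "V \<equiv> modular_space smul \<rho>"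

lemma summable_powers: "summable (\<lambda>n. norm (k ^ n))"
  by (rule spectral_radius_less_1_imp_summable[OF spectral])

lemma powers_tendsto_0: "(\<lambda>n. k ^ n) \<longlonglongrightarrow> 0"
  using summable_LIMSEQ_zero[OF summable_powers] by (rule tendsto_norm_zero_cancel)

text \<open>Lowering the left scale from \<alpha> to \<beta> puts the same scale on both sides, so
  the inequality can be iterated.\<close>

lemma contr': "x \<in> V \<Longrightarrow> y \<in> V \<Longrightarrow> \<rho> (\<beta> \<cdot> (T x - T y)) \<preceq> k * \<rho> (\<beta> \<cdot> (x - y))"
  using rho_mono[of \<beta> \<alpha>] scales by (intro le_trans[OF _ contr]) auto

text \<open>Iteration bounds the modular of the difference by \<open>k ^ n\<close> times itself,
  which tends to 0; the constant sequence is squeezed to 0.\<close>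

lemma fixed_point_unique:
  assumes "x \<in> V" "T x = x" "y \<in> V" "T y = y"
  shows "x = y"
proof -
  define w where "w = \<rho> (\<beta> \<cdot> (x - y))"
  have "w \<preceq> k * w"
    unfolding w_def using contr'[of x y] assms by simp
  then have "w \<preceq> k ^ n * w" for n
    using le_power_mult[OF k_mem, of "\<lambda>_. w"] by simp
  moreover have "(\<lambda>n. k ^ n * w) \<longlonglongrightarrow> 0"
    by (rule tendsto_mult_left_zero[OF powers_tendsto_0])
  ultimately have "(\<lambda>n::nat. w) \<longlonglongrightarrow> 0"
    by (intro tendsto_zero_mono[where f = "\<lambda>_. w"] always_eventually allI conjI)
      (simp_all add: rho_nonneg w_def)
  then show ?thesis
    using scales by (simp add: LIMSEQ_const_iff w_def rho_eq_0_iff)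
qed

text \<open>The start is 0 because it always lies in the modular space.\<close>

definition orbit :: "nat \<Rightarrow> 'v" where "orbit n = (T ^^ n) 0"

lemma orbit_0: "orbit 0 = 0" and orbit_Suc: "orbit (Suc n) = T (orbit n)"
  by (simp_all add: orbit_def)

lemma orbit_mem: "orbit n \<in> V"
  using self_map by (induction n) (auto simp: orbit_0 orbit_Suc zero_mem_modular_space)

lemma orbit_bounded: "\<exists>C. \<forall>p. norm (\<rho> (\<beta> \<cdot> (orbit p - orbit 0))) \<le> C"
proof -
  \<comment> \<open>The modular of the first displacement, at the second scale of
    \<open>rho_add\<close>; it is the same for every \<open>p\<close>.\<close>
  define c where "c = \<rho> ((\<alpha> * \<beta> / (\<alpha> - \<beta>)) \<cdot> (orbit 1 - orbit 0))"
  have step: "\<rho> (\<beta> \<cdot> (orbit (Suc p) - orbit 0)) \<preceq> k * \<rho> (\<beta> \<cdot> (orbit p - orbit 0)) + c" for p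
  proof -
    have "\<rho> (\<beta> \<cdot> (orbit (Suc p) - orbit 0)) \<preceq> \<rho> (\<alpha> \<cdot> (orbit (Suc p) - orbit 1)) + c"
      using rho_add[OF scales, of "orbit (Suc p) - orbit 1" "orbit 1 - orbit 0"]
      by (simp add: c_def)
    also have "\<dots> \<preceq> k * \<rho> (\<beta> \<cdot> (orbit p - orbit 0)) + c"
      using contr[OF orbit_mem orbit_mem, of p 0]
      by (intro le_add_mono le_refl) (simp add: orbit_Suc)
    finally show ?thesis .
  qed
  \<comment> \<open>At \<open>p = 0\<close> the difference is 0, hence so is its modular: the
    recursion starts at 0.\<close>
  have "norm (\<rho> (\<beta> \<cdot> (orbit p - orbit 0))) \<le> L * ((\<Sum>i. norm (k ^ i)) * norm c)" for p
    using norm_le_suminf[OF k_mem summable_powers, of "\<lambda>p. \<rho> (\<beta> \<cdot> (orbit p - orbit 0))" c p]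
      step rho_nonneg rho_eq_0_iff by simp
  then show ?thesis
    by blast
qed

lemma orbit_Cauchy: "modular_Cauchy smul \<rho> orbit"
proof -
  obtain C where C: "\<And>p. norm (\<rho> (\<beta> \<cdot> (orbit p - orbit 0))) \<le> C"
    using orbit_bounded by blast
  have bound: "norm (\<rho> (\<beta> \<cdot> (orbit (n + p) - orbit n))) \<le> L * (norm (k ^ n) * C)" for n p
  proof -
    have "\<rho> (\<beta> \<cdot> (orbit (n + p) - orbit n)) \<preceq> k ^ n * \<rho> (\<beta> \<cdot> (orbit p - orbit 0))"
      \<comment> \<open>The gap \<open>p\<close> stays fixed while the recursion runs over the
        starting index, so \<open>n\<close> contractions lead back to the bounded displacement from
        \<open>orbit 0\<close>.\<close>
      using le_power_mult[OF k_mem, of "\<lambda>n. \<rho> (\<beta> \<cdot> (orbit (n + p) - orbit n))" n]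
        contr'[OF orbit_mem orbit_mem] by (simp add: orbit_Suc)
    then have "norm (\<rho> (\<beta> \<cdot> (orbit (n + p) - orbit n)))
        \<le> L * norm (k ^ n * \<rho> (\<beta> \<cdot> (orbit p - orbit 0)))"
      by (intro normal rho_nonneg)
    also have "\<dots> \<le> L * (norm (k ^ n) * C)"
      using L_pos C
      by (intro mult_left_mono order_trans[OF norm_mult_ineq]) auto
    finally show ?thesis .
  qed
  have lim: "(\<lambda>n. L * (norm (k ^ n) * C)) \<longlonglongrightarrow> 0"
    by (intro tendsto_mult_right_zero tendsto_mult_left_zero tendsto_norm_zero powers_tendsto_0)
  have "\<exists>N. \<forall>n\<ge>N. \<forall>m\<ge>N. norm (\<rho> (\<beta> \<cdot> (orbit n - orbit m))) < \<epsilon>" if "\<epsilon> > 0" for \<epsilon>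
  proof -
    obtain N where N: "\<And>n. n \<ge> N \<Longrightarrow> L * (norm (k ^ n) * C) < \<epsilon>"
      using order_tendstoD(2)[OF lim \<open>\<epsilon> > 0\<close>] by (auto simp: eventually_sequentially)
    have "norm (\<rho> (\<beta> \<cdot> (orbit m - orbit n))) < \<epsilon>" if "N \<le> n" "n \<le> m" for m n
      using bound[of n "m - n"] N[of n] that by simp
    \<comment> \<open>The bound treats ordered indices; symmetry of the modular covers the other
      order.\<close>
    then show ?thesis
      using rho_scale_minus_commute[of "of_real \<beta>"] by (metis linear)
  qed
  then show ?thesis
    unfolding modular_Cauchy_def using scales(1) by blast
qed

lemma fixed_point_exists:
  assumes "modular_complete smul \<rho>" and "Delta2_condition smul \<rho>"
  shows "\<exists>x\<in>V. T x = x"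
proof -
  obtain x where x: "x \<in> V" and "modular_convergent smul \<rho> orbit x"
    using assms(1) orbit_Cauchy orbit_mem unfolding modular_complete_def by blast
  then obtain \<mu> where \<mu>: "\<mu> > 0" "(\<lambda>n. \<rho> (\<mu> \<cdot> (orbit n - x))) \<longlonglongrightarrow> 0"
    unfolding modular_convergent_def lim_sequentially dist_norm by auto
  \<comment> \<open>Completeness yields convergence at some scale \<mu> only, whereas the estimate
    below uses the scales \<beta> and \<gamma>.\<close>
  have lim: "(\<lambda>n. \<rho> (s \<cdot> (orbit n - x))) \<longlonglongrightarrow> 0" if "s \<ge> 0" for s
    using assms(2) diff_mem_modular_space[OF orbit_mem x] \<mu> that
    by (rule Delta2_tendsto_all_scales)
  define \<gamma> where "\<gamma> = \<alpha> * \<beta> / (\<alpha> - \<beta>)"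
  have \<gamma>: "\<gamma> \<ge> 0" using scales by (simp add: \<gamma>_def)
  \<comment> \<open>Inserting \<open>orbit (Suc n)\<close> between \<open>T x\<close> and
    \<open>x\<close> gives one difference of images, which contracts, and one distance to the
    limit.\<close>
  have "\<rho> (\<beta> \<cdot> (T x - x)) \<preceq> k * \<rho> (\<beta> \<cdot> (orbit n - x)) + \<rho> (\<gamma> \<cdot> (orbit (Suc n) - x))" for n
  proof -
    have "\<rho> (\<beta> \<cdot> (T x - x)) \<preceq> \<rho> (\<alpha> \<cdot> (T x - orbit (Suc n))) + \<rho> (\<gamma> \<cdot> (orbit (Suc n) - x))"
      using rho_add[OF scales, of "T x - orbit (Suc n)" "orbit (Suc n) - x"]
      by (simp add: \<gamma>_def)
    also have "\<dots> \<preceq> k * \<rho> (\<beta> \<cdot> (orbit n - x)) + \<rho> (\<gamma> \<cdot> (orbit (Suc n) - x))"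
      using contr[OF x orbit_mem, of n]
      by (intro le_add_mono le_refl) (simp add: orbit_Suc rho_scale_minus_commute[of _ x])
    finally show ?thesis .
  qed
  moreover have "(\<lambda>n. k * \<rho> (\<beta> \<cdot> (orbit n - x)) + \<rho> (\<gamma> \<cdot> (orbit (Suc n) - x))) \<longlonglongrightarrow> 0"
    using lim[OF \<gamma>] lim[of \<beta>] scales
    by (intro tendsto_add_zero tendsto_mult_right_zero LIMSEQ_Suc[of "\<lambda>n. \<rho> (\<gamma> \<cdot> (orbit n - x))"]) auto
  ultimately have "(\<lambda>n::nat. \<rho> (\<beta> \<cdot> (T x - x))) \<longlonglongrightarrow> 0"
    by (intro tendsto_zero_mono[where f = "\<lambda>_. \<rho> (\<beta> \<cdot> (T x - x))"] always_eventually allI conjI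
        rho_nonneg)
  then have "T x = x"
    using scales by (simp add: LIMSEQ_const_iff rho_eq_0_iff)
  with x show ?thesis by blast
qed

end

theorem theorem2p7:
  fixes scaleA :: "'k::real_normed_field \<Rightarrow> 'a::{real_normed_algebra, monoid_mult, banach} \<Rightarrow> 'a"
    and scaleV :: "'k \<Rightarrow> 'v::ab_group_add \<Rightarrow> 'v"
    and P :: "'a set"
    and \<rho> :: "'v \<Rightarrow> 'a"
    and T :: "'v \<Rightarrow> 'v"
  assumes "banach_algebra_over scaleA"
    and "algebra_cone P" and "normal_cone P" and "solid_cone P"
    and "vector_space scaleV"
    and "cone_modular scaleV P \<rho>"
    and "modular_complete scaleV \<rho>"
    and "Delta2_condition scaleV \<rho>"
    and "T \<in> modular_space scaleV \<rho> \<rightarrow> modular_space scaleV \<rho>"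
    and "cone_contractive scaleV P \<rho> T"
  shows "\<exists>!x. x \<in> modular_space scaleV \<rho> \<and> T x = x"
proof -
  obtain L where L: "L > 0" "\<And>x y. cone_le P 0 x \<Longrightarrow> cone_le P x y \<Longrightarrow> norm x \<le> L * norm y"
    using \<open>normal_cone P\<close> unfolding normal_cone_def by blast
  obtain k \<alpha> \<beta> where "k \<in> P" "spectral_radius k < 1" "\<beta> < \<alpha>" "0 < \<beta>"
    and "\<And>x y. x \<in> modular_space scaleV \<rho> \<Longrightarrow> y \<in> modular_space scaleV \<rho> \<Longrightarrow>
      cone_le P (\<rho> (scaleV (of_real \<alpha>) (T x - T y))) (k * \<rho> (scaleV (of_real \<beta>) (x - y)))"
    using \<open>cone_contractive scaleV P \<rho> T\<close> unfolding cone_contractive_def by blast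
  \<comment> \<open>The normality constant and the contraction data become fixed parameters.\<close>
  then interpret cone_contraction P L scaleV \<rho> T k \<alpha> \<beta>
    using assms L
    by (intro cone_contraction.intro cone_modular_functional.intro normal_algebra_cone.intro
        cone_modular_functional_axioms.intro cone_contraction_axioms.intro) auto
  show ?thesis
    using fixed_point_exists[OF assms(7,8)] fixed_point_unique by blast
qed

end
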